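(* For every integer $m\ge 1$ and every integer $k\equiv 1\pmod 4$ with $5\le k<12m+3$, there exists a Heffter array $H(12m+3;k)$.
   Context: For positive integers $n,k$, a (square integer) Heffter array $H(n;k)$ is an $n\times n$ array of integers, possibly with empty cells, such that: (1) each row and each column contains exactly $k$ filled cells; (2) the entries in every row and in every column sum to $0$ in $\mathbb{Z}$; (3) for every $x\in\{1,2,\ldots,nk\}$ either $x$ or $-x$ appears in the array (so, as there are exactly $nk$ filled cells, exactly one of $x,-x$ appears, exactly once). *)

theory Defs
  imports Main
begin

text \<open>
  A partially filled n by n array of integers is a function on row and column indices;
  \<open>None\<close> marks an empty cell, and only indices below n are meaningful.
\<close>

type_synonym int_array = "nat \<Rightarrow> nat \<Rightarrow> int option"

definition row_filled :: "nat \<Rightarrow> int_array \<Rightarrow> nat \<Rightarrow> nat set" where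
  "row_filled n A i = {j. j < n \<and> A i j \<noteq> None}"

definition col_filled :: "nat \<Rightarrow> int_array \<Rightarrow> nat \<Rightarrow> nat set" where
  "col_filled n A j = {i. i < n \<and> A i j \<noteq> None}"

text \<open>
  There are exactly \<open>n * k\<close> filled cells, so the last condition forces exactly one
  of x and -x to appear, exactly once, and excludes any entry outside this range up to sign
  (in particular 0).
\<close>

definition is_heffter_array :: "nat \<Rightarrow> nat \<Rightarrow> int_array \<Rightarrow> bool" where
  "is_heffter_array n k A \<longleftrightarrow>
     0 < n \<and> 0 < k \<and>
     (\<forall>i<n. card (row_filled n A i) = k) \<and>
     (\<forall>j<n. card (col_filled n A j) = k) \<and>
     (\<forall>i<n. (\<Sum>j\<in>row_filled n A i. the (A i j)) = 0) \<and>
     (\<forall>j<n. (\<Sum>i\<in>col_filled n A j. the (A i j)) = 0) \<and>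
     (\<forall>x\<in>{1..int (n * k)}. \<exists>i<n. \<exists>j<n. A i j = Some x \<or> A i j = Some (- x))"

end

theory Submission
  imports Defs
begin

text \<open>
  Put \<open>n = 12 m + 3\<close> and \<open>q = n / 3\<close>. An array supported on the diagonals \<open>j - i \<equiv> d\<close> for
  \<open>d \<in> F\<close> can be enlarged by any two disjoint pairs of adjacent diagonals carrying the next \<open>4 n\<close>
  absolute values, so it suffices to find a base array for \<open>k = 5\<close> whose diagonals leave enough
  adjacent pairs free. The base array uses the diagonals \<open>-1, 0, 1, q, 2 q\<close>.

  Diagonals 1 and \<open>-1\<close> carry translates of the cyclic zigzag
  \<open>0, (n + 1) / 2, 1, (n + 3) / 2, \<dots>\<close>, whose sums of cyclic neighbours are consecutive integers.
  Adding minus these sums plus a perturbation \<open>R i = defect m i\<close> on diagonal 0, row \<open>i\<close> and column \<open>i\<close> both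
  sum to \<open>R i\<close>.
  Diagonals \<open>q\<close> and \<open>2 q\<close> split into 3 by 3 blocks on the rows \<open>t, t + q, t + 2 q\<close> and can
  cancel \<open>R\<close> in each block. If \<open>R\<close> takes the values \<open>-3, -1, 1\<close> on these three rows, the block
  covers six consecutive absolute values; and \<open>R\<close> can be chosen such that the entries of diagonal 0
  remain a permutation of an interval.
\<close>

section \<open>Arrays supported on cyclic diagonals\<close>

text \<open>\<open>f d i\<close> sits in row \<open>i\<close> and column
  \<open>(i + d) mod n\<close>, so column \<open>j\<close> meets diagonal \<open>d\<close> in row
  \<open>(j + n - d) mod n\<close>; adding \<open>n\<close> first keeps the subtraction on naturals
  from truncating.\<close>

definition diagonal_heffter :: "nat \<Rightarrow> nat set \<Rightarrow> (nat \<Rightarrow> nat \<Rightarrow> int) \<Rightarrow> bool" where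
  "diagonal_heffter n F f \<longleftrightarrow>
     0 < n \<and> F \<noteq> {} \<and> F \<subseteq> {..<n} \<and>
     (\<forall>i<n. (\<Sum>d\<in>F. f d i) = 0) \<and>
     (\<forall>j<n. (\<Sum>d\<in>F. f d ((j + n - d) mod n)) = 0) \<and>
     (\<forall>x\<in>{1..int (n * card F)}. \<exists>d\<in>F. \<exists>i<n. \<bar>f d i\<bar> = x)"

lemma column_of_diagonal:
  fixes i d n :: nat
  assumes "i < n" "d < n"
  shows "((i + d) mod n + n - i) mod n = d"
  using assms by (cases "i + d < n") (auto simp: mod_if)

lemma row_of_diagonal:
  fixes j d n :: nat
  assumes "j < n" "d < n"
  shows "(j + n - (j + n - d) mod n) mod n = d"
  using assms by (cases "d \<le> j") (auto simp: mod_if)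

lemma diagonal_index_column:
  fixes i j n :: nat
  assumes "i < n" "j < n"
  shows "(i + (j + n - i) mod n) mod n = j"
  using assms by (cases "i \<le> j") (auto simp: mod_if)

text \<open>In a fixed row or column the filled cells biject with \<open>F\<close>, by d -> i + d or
  d -> j - d modulo \<open>n\<close>, so counting and summing over cells becomes counting and
  summing over \<open>F\<close>.\<close>

lemma diagonal_heffter_imp_heffter_array:
  assumes "diagonal_heffter n F f"
  shows "\<exists>A. is_heffter_array n (card F) A"
proof -
  have n: "0 < n" and F: "F \<noteq> {}" "F \<subseteq> {..<n}"
    and rows: "\<And>i. i < n \<Longrightarrow> (\<Sum>d\<in>F. f d i) = 0"
    and cols: "\<And>j. j < n \<Longrightarrow> (\<Sum>d\<in>F. f d ((j + n - d) mod n)) = 0"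
    and cover: "\<And>x. x \<in> {1..int (n * card F)} \<Longrightarrow> \<exists>d\<in>F. \<exists>i<n. \<bar>f d i\<bar> = x"
    using assms unfolding diagonal_heffter_def by blast+
  have fin: "finite F"
    using F(2) finite_subset by blast
  have lt: "d < n" if "d \<in> F" for d
    using that F(2) by auto
  define A where
    "A i j = (let d = (j + n - i) mod n in if d \<in> F then Some (f d i) else None)" for i j
  have row_set: "row_filled n A i = (\<lambda>d. (i + d) mod n) ` F" if "i < n" for i
  proof (intro set_eqI iffI)
    fix j assume "j \<in> row_filled n A i"
    then have "j < n" "(j + n - i) mod n \<in> F"
      by (auto simp: row_filled_def A_def Let_def split: if_splits)
    then show "j \<in> (\<lambda>d. (i + d) mod n) ` F"
      using diagonal_index_column[OF that \<open>j < n\<close>] by (metis image_eqI)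
  next
    fix j assume "j \<in> (\<lambda>d. (i + d) mod n) ` F"
    then show "j \<in> row_filled n A i"
      using column_of_diagonal[OF that lt] n by (auto simp: row_filled_def A_def)
  qed
  have col_set: "col_filled n A j = (\<lambda>d. (j + n - d) mod n) ` F" if "j < n" for j
  proof (intro set_eqI iffI)
    fix i assume "i \<in> col_filled n A j"
    then have "i < n" "(j + n - i) mod n \<in> F"
      by (auto simp: col_filled_def A_def Let_def split: if_splits)
    then show "i \<in> (\<lambda>d. (j + n - d) mod n) ` F"
      using row_of_diagonal[OF that \<open>i < n\<close>] by (metis image_eqI)
  next
    fix i assume "i \<in> (\<lambda>d. (j + n - d) mod n) ` F"
    then show "i \<in> col_filled n A j"
      using row_of_diagonal[OF that lt] n by (auto simp: col_filled_def A_def)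
  qed
  have row_inj: "inj_on (\<lambda>d. (i + d) mod n) F" if "i < n" for i
    by (rule inj_on_inverseI[where g = "\<lambda>j. (j + n - i) mod n"])
      (use column_of_diagonal[OF that lt] in auto)
  have col_inj: "inj_on (\<lambda>d. (j + n - d) mod n) F" if "j < n" for j
    by (rule inj_on_inverseI[where g = "\<lambda>i. (j + n - i) mod n"])
      (use row_of_diagonal[OF that lt] in auto)
  have "is_heffter_array n (card F) A"
    unfolding is_heffter_array_def
  proof (intro conjI allI impI ballI)
    show "0 < n" by (rule n)
    show "0 < card F" using fin F(1) by (simp add: card_gt_0_iff)
    show "card (row_filled n A i) = card F" if "i < n" for i
      using row_set[OF that] row_inj[OF that] by (simp add: card_image)
    show "card (col_filled n A j) = card F" if "j < n" for j
      using col_set[OF that] col_inj[OF that] by (simp add: card_image)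
    show "(\<Sum>j\<in>row_filled n A i. the (A i j)) = 0" if "i < n" for i
    proof -
      have "(\<Sum>j\<in>row_filled n A i. the (A i j)) = (\<Sum>d\<in>F. the (A i ((i + d) mod n)))"
        using row_set[OF that] row_inj[OF that] by (simp add: sum.reindex)
      also have "\<dots> = (\<Sum>d\<in>F. f d i)"
        by (rule sum.cong) (simp_all add: A_def column_of_diagonal[OF that lt])
      finally show ?thesis using rows[OF that] by simp
    qed
    show "(\<Sum>i\<in>col_filled n A j. the (A i j)) = 0" if "j < n" for j
    proof -
      have "(\<Sum>i\<in>col_filled n A j. the (A i j)) = (\<Sum>d\<in>F. the (A ((j + n - d) mod n) j))"
        using col_set[OF that] col_inj[OF that] by (simp add: sum.reindex)
      also have "\<dots> = (\<Sum>d\<in>F. f d ((j + n - d) mod n))"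
        by (rule sum.cong) (simp_all add: A_def row_of_diagonal[OF that lt])
      finally show ?thesis using cols[OF that] by simp
    qed
    fix x assume "x \<in> {1..int (n * card F)}"
    then obtain d i where di: "d \<in> F" "i < n" "\<bar>f d i\<bar> = x"
      using cover by blast
    then have "A i ((i + d) mod n) = Some (f d i)"
      by (simp add: A_def column_of_diagonal lt)
    moreover have "f d i = x \<or> f d i = - x"
      using di(3) by linarith
    ultimately show "\<exists>i<n. \<exists>j<n. A i j = Some x \<or> A i j = Some (- x)"
      using di(2) n by (metis mod_less_divisor)
  qed
  then show ?thesis by blast
qed

section \<open>Adding two pairs of adjacent diagonals\<close>

text \<open>
  The two new pairs of diagonals have row sums \<open>-1\<close> and \<open>1\<close>. Indexing both pairs by the column
  of the left diagonal puts both wrap-around defects into column 0, where they cancel.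
\<close>

lemma diagonal_heffter_add_two_pairs:
  assumes f: "diagonal_heffter n F f"
    and a: "Suc a < n" "a \<notin> F" "Suc a \<notin> F"
    and b: "Suc b < n" "b \<notin> F" "Suc b \<notin> F"
    and ab: "a \<noteq> b" "a \<noteq> Suc b" "b \<noteq> Suc a"
  shows "\<exists>g. diagonal_heffter n (F \<union> {a, Suc a, b, Suc b}) g"
proof -
  have n: "0 < n" and F: "F \<noteq> {}" "F \<subseteq> {..<n}"
    and rows: "\<And>i. i < n \<Longrightarrow> (\<Sum>d\<in>F. f d i) = 0"
    and cols: "\<And>j. j < n \<Longrightarrow> (\<Sum>d\<in>F. f d ((j + n - d) mod n)) = 0"
    and cover: "\<And>x. x \<in> {1..int (n * card F)} \<Longrightarrow> \<exists>d\<in>F. \<exists>i<n. \<bar>f d i\<bar> = x"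
    using f unfolding diagonal_heffter_def by blast+
  have fin: "finite F"
    using F(2) finite_subset by blast
  define N where "N = int (n * card F)"
  define c where "c d i = int ((i + d) mod n)" for d i :: nat
  \<comment> \<open>The first pair takes the absolute values N + 1 to N + 2n, the second the next
    2n. Column sums are 1 and -1, except 1 - 2n and 2n - 1 in column 0.\<close>
  define g where "g d i =
    (if d = a then N + 1 + 2 * c a i
     else if d = Suc a then - (N + 2 + 2 * c a i)
     else if d = b then - (N + 2 * int n + 1 + 2 * c b i)
     else if d = Suc b then N + 2 * int n + 2 + 2 * c b i
     else f d i)" for d i
  have g_old: "g d i = f d i" if "d \<in> F" for d i
    using that a b by (auto simp: g_def)
  have g_new: "g a i = N + 1 + 2 * c a i" "g (Suc a) i = - (N + 2 + 2 * c a i)"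
    "g b i = - (N + 2 * int n + 1 + 2 * c b i)" "g (Suc b) i = N + 2 * int n + 2 + 2 * c b i" for i
    using ab by (auto simp: g_def)
  have split: "(\<Sum>d\<in>F \<union> {a, Suc a, b, Suc b}. h d) =
      (\<Sum>d\<in>F. h d) + (h a + h (Suc a) + h b + h (Suc b))" for h :: "nat \<Rightarrow> int"
  proof -
    have "(\<Sum>d\<in>F \<union> {a, Suc a, b, Suc b}. h d) =
        (\<Sum>d\<in>F. h d) + (\<Sum>d\<in>{a, Suc a, b, Suc b}. h d)"
      by (rule sum.union_disjoint) (use fin a b in auto)
    also have "(\<Sum>d\<in>{a, Suc a, b, Suc b}. h d) = h a + h (Suc a) + h b + h (Suc b)"
      using ab by simp
    finally show ?thesis .
  qed
  have card: "card (F \<union> {a, Suc a, b, Suc b}) = card F + 4"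
  proof -
    have "card (F \<union> {a, Suc a, b, Suc b}) = card F + card {a, Suc a, b, Suc b}"
      by (rule card_Un_disjoint) (use fin a b in auto)
    then show ?thesis using ab by simp
  qed
  have c_left: "c d ((j + n - d) mod n) = int j" if "j < n" "d < n" for j d
    using that by (cases "d \<le> j") (auto simp: c_def mod_if)
  \<comment> \<open>The left neighbour of column 0 is column n - 1; this is the wrap-around.\<close>
  have c_right: "c d ((j + n - Suc d) mod n) = (if j = 0 then int n - 1 else int j - 1)"
    if "j < n" "Suc d < n" for j d
    using that by (cases "Suc d \<le> j") (auto simp: c_def mod_if)
  have left: "\<exists>i<n. c d i = int j" if "j < n" "d < n" for j d
    using c_left[OF that] n by (metis mod_less_divisor)
  have "diagonal_heffter n (F \<union> {a, Suc a, b, Suc b}) g"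
    unfolding diagonal_heffter_def
  proof (intro conjI allI impI ballI)
    show "0 < n" by (rule n)
    show "F \<union> {a, Suc a, b, Suc b} \<noteq> {}" by simp
    show "F \<union> {a, Suc a, b, Suc b} \<subseteq> {..<n}" using F a b by auto
    show "(\<Sum>d\<in>F \<union> {a, Suc a, b, Suc b}. g d i) = 0" if "i < n" for i
      unfolding split g_new using rows[OF that] by (simp add: g_old)
    show "(\<Sum>d\<in>F \<union> {a, Suc a, b, Suc b}. g d ((j + n - d) mod n)) = 0" if "j < n" for j
      unfolding split g_new using cols[OF that] that a b
      by (simp add: g_old c_left c_right del: diff_Suc_Suc)
    fix x assume "x \<in> {1..int (n * card (F \<union> {a, Suc a, b, Suc b}))}"
    then have x: "1 \<le> x" "x \<le> N + 4 * int n"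
      unfolding card by (auto simp: N_def algebra_simps)
    show "\<exists>d\<in>F \<union> {a, Suc a, b, Suc b}. \<exists>i<n. \<bar>g d i\<bar> = x"
    proof (cases "x \<le> N")
      case True
      then obtain d i where "d \<in> F" "i < n" "\<bar>f d i\<bar> = x"
        using cover[of x] x by (auto simp: N_def)
      then show ?thesis using g_old by (metis UnI1)
    next
      case False
      have N: "0 \<le> N" by (simp add: N_def)
      define y where "y = x - N - 1"
      have y: "0 \<le> y" "y < 4 * int n" "x = N + 1 + y"
        using x False by (auto simp: y_def)
      show ?thesis
      proof (cases "y < 2 * int n")
        case True
        \<comment> \<open>\<open>y div 2\<close> selects the cell, the parity of \<open>y\<close>
          selects the diagonal of the pair.\<close>
        then have "nat (y div 2) < n" using y by linarith
        then obtain i where i: "i < n" "c a i = y div 2"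
          using left[of "nat (y div 2)" a] a y by auto
        have "\<bar>g a i\<bar> = x \<or> \<bar>g (Suc a) i\<bar> = x"
          unfolding g_new i(2) using y N minus_div_mult_eq_mod[of y 2] pos_mod_bound[of 2 y] pos_mod_sign[of 2 y] by linarith
        then show ?thesis using i(1) by blast
      next
        case False
        define z where "z = y - 2 * int n"
        have z: "0 \<le> z" "z < 2 * int n" "x = N + 2 * int n + 1 + z"
          using y False by (auto simp: z_def)
        then have "nat (z div 2) < n" by linarith
        then obtain i where i: "i < n" "c b i = z div 2"
          using left[of "nat (z div 2)" b] b z by auto
        have "\<bar>g b i\<bar> = x \<or> \<bar>g (Suc b) i\<bar> = x"
          unfolding g_new i(2) using z N minus_div_mult_eq_mod[of z 2] pos_mod_bound[of 2 z] pos_mod_sign[of 2 z] by linarith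
        then show ?thesis using i(1) by blast
      qed
    qed
  qed
  then show ?thesis by blast
qed

section \<open>The base array for k = 5\<close>

text \<open>For i < n this is i / 2 modulo the odd number n = 12m + 3; doubling modulo n inverts
  it.\<close>

definition zigzag :: "nat \<Rightarrow> nat \<Rightarrow> int" where
  "zigzag m i = int (if even i then i div 2 else (12 * m + 3 + i) div 2)"

definition defect :: "nat \<Rightarrow> nat \<Rightarrow> int" where
  "defect m i =
    (if i mod 4 = 0 then -3
     else if i mod 4 = 2 then 1
     else if 4 * m < i then -1
     else if i mod 4 = 1 then -3 else 1)"

text \<open>Block \<open>t\<close> is to cover \<open>offset m t - 4\<close> to
  \<open>offset m t + 1\<close>. The jump 36m + 9 = 3n reserves the interval from 6m + 1 to 42m + 9
  for the diagonals 1, n - 1 and 0.\<close>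

definition offset :: "nat \<Rightarrow> nat \<Rightarrow> int" where
  "offset m t = 6 * int t + 5 + (if t < m then 0 else 36 * int m + 9)"

text \<open>\<open>i'\<close> is row i - 1 and \<open>i''\<close> is row i - q, since 2q = -q modulo
  n. The constants 6m + 1 and 18m + 4 start intervals of length n, and 24m + 5 is their sum.\<close>

definition base_entry :: "nat \<Rightarrow> nat \<Rightarrow> nat \<Rightarrow> int" where
  "base_entry m d i =
    (let n = 12 * m + 3; q = 4 * m + 1; i' = (i + (n - 1)) mod n; i'' = (i + 2 * q) mod n in
     if d = 0 then defect m i - (24 * int m + 5) - zigzag m i - zigzag m i'
     else if d = 1 then 6 * int m + 1 + zigzag m i
     else if d = n - 1 then 18 * int m + 4 + zigzag m i'
     else if d = q then offset m (i mod q) + defect m i''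
     else - (offset m (i mod q) + defect m i + defect m i''))"

definition base_diagonals :: "nat \<Rightarrow> nat set" where
  "base_diagonals m = {0, 1, 12 * m + 2, 4 * m + 1, 8 * m + 2}"

section \<open>Zigzag sums and defects\<close>

text \<open>Neighbours have opposite parity, so exactly one contributes an extra n / 2. For i = 0
  the predecessor n - 1 is even, and 0 + (n - 1) / 2 fits the same formula.\<close>

lemma zigzag_add_previous:
  assumes "i < 12 * m + 3"
  shows "zigzag m i + zigzag m ((i + (12 * m + 2)) mod (12 * m + 3)) = int i + 6 * int m + 1"
proof (cases "i = 0")
  case True
  then show ?thesis by (simp add: zigzag_def)
next
  case False
  then have "i + (12 * m + 2) = (i - 1) + (12 * m + 3)" by simp
  then have "(i + (12 * m + 2)) mod (12 * m + 3) = i - 1"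
    using assms by (metis mod_add_self2 mod_less less_imp_diff_less)
  moreover have "zigzag m i + zigzag m (i - 1) = int i + 6 * int m + 1"
  proof (cases "even i")
    case True
    then obtain k where "i = 2 * k" ..
    moreover from this False obtain l where "k = Suc l" by (cases k) auto
    ultimately show ?thesis by (simp add: zigzag_def)
  next
    case False
    then obtain k where "i = 2 * k + 1" ..
    then show ?thesis by (simp add: zigzag_def)
  qed
  ultimately show ?thesis by simp
qed

lemma zigzag_surj:
  assumes "0 \<le> x" "x < 12 * int m + 3"
  obtains i where "i < 12 * m + 3" "zigzag m i = x"
proof (cases "x \<le> 6 * int m + 1")
  case True
  then have "zigzag m (2 * nat x) = x" "2 * nat x < 12 * m + 3"
    using assms by (auto simp: zigzag_def)
  then show ?thesis using that by blast
next
  case False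
  define i where "i = nat (2 * x - (12 * int m + 3))"
  have "int i = 2 * x - (12 * int m + 3)" using False by (simp add: i_def)
  then have "zigzag m i = x" "i < 12 * m + 3"
    using assms unfolding zigzag_def by presburger+
  then show ?thesis using that by blast
qed

text \<open>
  \<open>i \<mapsto> i - (defect m i + 1)\<close> swaps \<open>i\<close> and \<open>i + 2\<close> for \<open>i \<equiv> 0\<close> modulo 4, also for
  \<open>i \<equiv> 1\<close> modulo 4 in the first third, and fixes the remaining rows.
\<close>

lemma defect_shift_surj:
  assumes "0 \<le> x" "x < 12 * int m + 3"
  obtains i where "i < 12 * m + 3" "int i - defect m i - 1 = x"
proof -
  define y where "y = nat x"
  have y: "y < 12 * m + 3" "x = int y" using assms by (auto simp: y_def)
  have "\<exists>i<12 * m + 3. int i - defect m i - 1 = x"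
  proof -
    have "y mod 4 = 0 \<or> y mod 4 = 1 \<or> y mod 4 = 2 \<or> y mod 4 = 3"
      by presburger
    then consider "y mod 4 = 0" | "y mod 4 = 2" | "y mod 4 \<noteq> 0" "y mod 4 \<noteq> 2" "4 * m < y"
      | "y mod 4 = 1" "\<not> 4 * m < y" | "y mod 4 = 3" "\<not> 4 * m < y"
      by metis
    then show ?thesis
    proof cases
      case 1
      \<comment> \<open>As n is 3 modulo 4, the swap partner y + 2 stays below n.\<close>
      then have "(y + 2) mod 4 = 2" "y + 2 < 12 * m + 3" using y(1) by presburger+
      then show ?thesis by (intro exI[of _ "y + 2"]) (simp add: defect_def y(2))
    next
      case 2
      then have "(y - 2) mod 4 = 0" "2 \<le> y" by presburger+
      then show ?thesis using y by (intro exI[of _ "y - 2"]) (simp add: defect_def)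
    next
      case 3
      then show ?thesis using y by (intro exI[of _ y]) (simp add: defect_def)
    next
      case 4
      \<comment> \<open>Here y is at most 4m - 3, so the swapped pair does not leave the first
        third.\<close>
      then have "(y + 2) mod 4 = 3" "y + 2 \<le> 4 * m" by presburger+
      then show ?thesis by (intro exI[of _ "y + 2"]) (simp add: defect_def y(2))
    next
      case 5
      define z where "z = 4 * (y div 4) + 1"
      have z: "y = z + 2" "z mod 4 = 1"
        using 5(1) div_mult_mod_eq[of y 4] by (simp_all add: z_def)
      have "z < 12 * m + 3" "\<not> 4 * m < z" using 5(2) z(1) by simp_all
      then show ?thesis by (intro exI[of _ z]) (simp add: defect_def z(2) y(2) z(1))
    qed
  qed
  then show ?thesis using that by blast
qed

text \<open>Since q = 4m + 1 is 1 modulo 4, the three rows have consecutive residues modulo 4, and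
  only row \<open>t\<close> lies in the first third; each of the four residues of \<open>t\<close>
  then gives all three values.\<close>

lemma defect_transversal:
  assumes "t < 4 * m + 1"
  shows "{defect m t, defect m (t + (4 * m + 1)), defect m (t + (8 * m + 2))} = {-3, -1, 1}"
    and "defect m t + defect m (t + (4 * m + 1)) + defect m (t + (8 * m + 2)) = -3"
proof -
  have a: "(t + (4 * m + 1)) mod 4 = (t + 1) mod 4" and b: "(t + (8 * m + 2)) mod 4 = (t + 2) mod 4"
    by presburger+
  consider "t mod 4 = 0" | "t mod 4 = 1" | "t mod 4 = 2" | "t mod 4 = 3" by linarith
  then have "{defect m t, defect m (t + (4 * m + 1)), defect m (t + (8 * m + 2))} = {-3, -1, 1} \<and>
    defect m t + defect m (t + (4 * m + 1)) + defect m (t + (8 * m + 2)) = -3"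
  proof cases
    case 1
    then have "(t + 1) mod 4 = 1" "(t + 2) mod 4 = 2" by presburger+
    then show ?thesis using 1 assms unfolding defect_def a b by auto
  next
    case 2
    then have "(t + 1) mod 4 = 2" "(t + 2) mod 4 = 3" by presburger+
    then show ?thesis using 2 assms unfolding defect_def a b by auto
  next
    case 3
    then have "(t + 1) mod 4 = 3" "(t + 2) mod 4 = 0" by presburger+
    then show ?thesis using 3 assms unfolding defect_def a b by auto
  next
    case 4
    then have "(t + 1) mod 4 = 0" "(t + 2) mod 4 = 1" by presburger+
    then show ?thesis using 4 assms unfolding defect_def a b by auto
  qed
  then show "{defect m t, defect m (t + (4 * m + 1)), defect m (t + (8 * m + 2))} = {-3, -1, 1}"
    and "defect m t + defect m (t + (4 * m + 1)) + defect m (t + (8 * m + 2)) = -3"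
    by blast+
qed

section \<open>Verification of the base array\<close>

lemma sum_base_diagonals:
  fixes h :: "nat \<Rightarrow> int"
  assumes "1 \<le> m"
  shows "(\<Sum>d\<in>base_diagonals m. h d) =
    h 0 + h 1 + h (12 * m + 2) + h (4 * m + 1) + h (8 * m + 2)"
  using assms unfolding base_diagonals_def by simp

lemma card_base_diagonals:
  assumes "1 \<le> m"
  shows "card (base_diagonals m) = 5"
  using assms unfolding base_diagonals_def by simp

lemma base_entry_simps:
  assumes "1 \<le> m"
  shows "base_entry m 0 i = defect m i - (24 * int m + 5) -
      (zigzag m i + zigzag m ((i + (12 * m + 2)) mod (12 * m + 3)))"
    and "base_entry m 1 i = 6 * int m + 1 + zigzag m i"
    and "base_entry m (12 * m + 2) i =
      18 * int m + 4 + zigzag m ((i + (12 * m + 2)) mod (12 * m + 3))"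
    and "base_entry m (4 * m + 1) i =
      offset m (i mod (4 * m + 1)) + defect m ((i + (8 * m + 2)) mod (12 * m + 3))"
    and "base_entry m (8 * m + 2) i =
      - (offset m (i mod (4 * m + 1)) + defect m i + defect m ((i + (8 * m + 2)) mod (12 * m + 3)))"
  using assms by (simp_all add: base_entry_def Let_def)

text \<open>Column \<open>j\<close> meets diagonals q and 2q in rows j + 2q and j + q modulo n = 3q.
  Both rows share the offset of \<open>j\<close> and the defect of j + q, which cancel; what remains
  is minus the defect of \<open>j\<close>, balancing the other three diagonals.\<close>

lemma base_column_sum:
  assumes m: "1 \<le> m" and j: "j < 12 * m + 3"
  shows "(\<Sum>d\<in>base_diagonals m. base_entry m d ((j + (12 * m + 3) - d) mod (12 * m + 3))) = 0"
proof -
  let ?n = "12 * m + 3" and ?q = "4 * m + 1"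
  have 0: "(j + ?n - 0) mod ?n = j" using j by simp
  have 1: "(j + ?n - 1) mod ?n = (j + (12 * m + 2)) mod ?n" by simp
  have 2: "((j + ?n - (12 * m + 2)) mod ?n + (12 * m + 2)) mod ?n = j"
    using j by (simp add: mod_if)
  define r where "r = (j + ?q) mod ?n"
  have q: "(j + ?n - ?q) mod ?n = (j + (8 * m + 2)) mod ?n"
    by (rule arg_cong[where f = "\<lambda>x. x mod ?n"]) simp
  have qq: "(j + ?n - (8 * m + 2)) mod ?n = r"
    unfolding r_def by (rule arg_cong[where f = "\<lambda>x. x mod ?n"]) simp
  have "((j + (8 * m + 2)) mod ?n + (8 * m + 2)) mod ?n = (j + (8 * m + 2) + (8 * m + 2)) mod ?n"
    by (rule mod_add_left_eq)
  also have "j + (8 * m + 2) + (8 * m + 2) = j + ?q + ?n" by simp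
  also have "(j + ?q + ?n) mod ?n = r" unfolding r_def by (rule mod_add_self2)
  finally have q_next: "((j + (8 * m + 2)) mod ?n + (8 * m + 2)) mod ?n = r" .
  have "(r + (8 * m + 2)) mod ?n = (j + ?q + (8 * m + 2)) mod ?n"
    unfolding r_def by (rule mod_add_left_eq)
  also have "j + ?q + (8 * m + 2) = j + ?n" by simp
  finally have qq_next: "(r + (8 * m + 2)) mod ?n = j" using j by simp
  have n: "?n = 3 * ?q" by simp
  have mod_q: "x mod ?n mod ?q = x mod ?q" for x
    unfolding n by (rule mod_mod_cancel) (rule dvd_triv_right)
  have q_mod: "(j + (8 * m + 2)) mod ?n mod ?q = j mod ?q"
  proof -
    have "j + (8 * m + 2) = j + ?q * 2" by simp
    then show ?thesis unfolding mod_q by (metis mod_mult_self2)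
  qed
  have qq_mod: "r mod ?q = j mod ?q"
    unfolding r_def mod_q by (rule mod_add_self2)
  show ?thesis
    unfolding sum_base_diagonals[OF m] 0 1 q qq base_entry_simps[OF m] 2 q_next qq_next q_mod qq_mod
    by simp
qed

lemma defect_row:
  assumes "t < 4 * m + 1" "c \<in> {-3, -1, 1}"
  obtains s where "s \<in> {0, 1, 2}" "defect m (t + s * (4 * m + 1)) = c"
proof -
  have "c \<in> {defect m t, defect m (t + (4 * m + 1)), defect m (t + (8 * m + 2))}"
    using defect_transversal(1)[OF assms(1)] assms(2) by simp
  moreover have "2 * (4 * m + 1) = 8 * m + 2" by simp
  ultimately show thesis using that[of 0] that[of 1] that[of 2] by auto
qed

text \<open>Diagonal q gives the odd e as single defects. On diagonal 2q two of three defects with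
  sum -3 are added, giving -3 minus the third, hence the even e. As the offset is at least 5, the
  absolute values are as expected.\<close>

lemma base_pair_cover:
  assumes m: "1 \<le> m" and t: "t < 4 * m + 1" and o: "e \<in> {-4..1}"
  shows "\<exists>d\<in>base_diagonals m. \<exists>i<12 * m + 3. \<bar>base_entry m d i\<bar> = offset m t + e"
proof -
  let ?n = "12 * m + 3" and ?q = "4 * m + 1"
  have pos: "5 \<le> offset m t" by (simp add: offset_def)
  have row: "(t + s * ?q) mod ?q = t" for s using t by (metis mod_mult_self1 mod_less)
  have multiples: "t + 0 * ?q = t" "t + 1 * ?q = t + ?q" "t + 2 * ?q = t + (8 * m + 2)"
    by simp_all
  have "t + ?q + (8 * m + 2) = t + ?n" "t + (8 * m + 2) + (8 * m + 2) = t + ?q + ?n" by simp_all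
  then have wrap: "(t + (8 * m + 2)) mod ?n = t + (8 * m + 2)"
    "(t + ?q + (8 * m + 2)) mod ?n = t" "(t + (8 * m + 2) + (8 * m + 2)) mod ?n = t + ?q"
    using t by (simp_all only: mod_add_self2, simp_all)
  consider "e \<in> {-3, -1, 1}" | "-3 - e \<in> {-3, -1, 1}" using o by fastforce
  then show ?thesis
  proof cases
    case 1
    obtain s where s: "s \<in> {0, 1, 2}" "defect m (t + s * ?q) = e"
      using defect_row[OF t 1] .
    \<comment> \<open>Row i on diagonal q carries the defect of row i - q, so the wanted entry is
      one block row further down.\<close>
    define s' where "s' = (if s = 2 then 0 else s + 1)"
    consider "s = 0" "s' = 1" | "s = 1" "s' = 2" | "s = 2" "s' = 0"
      using s(1) by (auto simp: s'_def)
    then have "(t + s' * ?q + (8 * m + 2)) mod ?n = t + s * ?q \<and> t + s' * ?q < ?n"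
      using t by cases (simp_all only: multiples wrap, simp_all)
    then have "\<bar>base_entry m ?q (t + s' * ?q)\<bar> = offset m t + e \<and> t + s' * ?q < ?n"
      using s pos o unfolding base_entry_simps[OF m] row by simp_all
    then show ?thesis unfolding base_diagonals_def by blast
  next
    case 2
    obtain s where s: "s \<in> {0, 1, 2}" "defect m (t + s * ?q) = -3 - e"
      using defect_row[OF t 2] .
    \<comment> \<open>Row i on diagonal 2q omits the defect of row i + q, so the wanted entry is one
      block row further up.\<close>
    define s' where "s' = (if s = 0 then 2 else s - 1)"
    consider "s = 0" "s' = 2" | "s = 1" "s' = 0" | "s = 2" "s' = 1"
      using s(1) by (auto simp: s'_def)
    then have "t + s' * ?q < ?n \<and>
        defect m (t + s' * ?q) + defect m ((t + s' * ?q + (8 * m + 2)) mod ?n) = e"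
      using t s(2) defect_transversal(2)[OF t]
      by cases (simp_all only: multiples wrap, simp_all)
    then have "\<bar>base_entry m (8 * m + 2) (t + s' * ?q)\<bar> = offset m t + e \<and> t + s' * ?q < ?n"
      using pos o unfolding base_entry_simps[OF m] row by simp
    then show ?thesis unfolding base_diagonals_def by blast
  qed
qed

lemma offset_cover:
  assumes "x \<in> {1..6 * int m} \<union> {42 * int m + 10..60 * int m + 15}"
  obtains t e where "t < 4 * m + 1" "e \<in> {-4..1}" "x = offset m t + e"
proof -
  \<comment> \<open>Closing the gap of length 3n makes the range 0 to 24m + 5, cut into one run of
    six per block.\<close>
  define v where "v = x - 1 - (if x \<le> 6 * int m then 0 else 36 * int m + 9)"
  define t where "t = nat (v div 6)"
  have v: "0 \<le> v" "v < 24 * int m + 6" "v < 6 * int m \<longleftrightarrow> x \<le> 6 * int m"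
    using assms by (auto simp: v_def)
  have t: "int t = v div 6" using v(1) by (simp add: t_def)
  have "t < 4 * m + 1" "t < m \<longleftrightarrow> x \<le> 6 * int m" using v t by linarith+
  moreover have "v mod 6 - 4 \<in> {-4..1}" by simp
  moreover have "x = offset m t + (v mod 6 - 4)"
    using calculation(2) t div_mult_mod_eq[of v 6] unfolding offset_def by (simp add: v_def)
  ultimately show thesis using that by blast
qed

lemma base_heffter:
  assumes m: "1 \<le> m"
  shows "diagonal_heffter (12 * m + 3) (base_diagonals m) (base_entry m)"
  unfolding diagonal_heffter_def
proof (intro conjI allI impI ballI)
  show "0 < 12 * m + 3" by simp
  show "base_diagonals m \<noteq> {}" "base_diagonals m \<subseteq> {..<12 * m + 3}"
    by (auto simp: base_diagonals_def)
  show "(\<Sum>d\<in>base_diagonals m. base_entry m d i) = 0" for i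
    unfolding sum_base_diagonals[OF m] base_entry_simps[OF m] by simp
  show "(\<Sum>d\<in>base_diagonals m. base_entry m d ((j + (12 * m + 3) - d) mod (12 * m + 3))) = 0"
    if "j < 12 * m + 3" for j
    by (rule base_column_sum[OF m that])
  fix x assume "x \<in> {1..int ((12 * m + 3) * card (base_diagonals m))}"
  then have x: "1 \<le> x" "x \<le> 60 * int m + 15"
    unfolding card_base_diagonals[OF m] by simp_all
  have in_base: "0 \<in> base_diagonals m" "1 \<in> base_diagonals m" "12 * m + 2 \<in> base_diagonals m"
    by (auto simp: base_diagonals_def)
  \<comment> \<open>The cases belong to diagonals q and 2q together, then 1, n - 1 and 0.\<close>
  consider "x \<in> {1..6 * int m} \<union> {42 * int m + 10..60 * int m + 15}"
    | "6 * int m + 1 \<le> x" "x < 18 * int m + 4"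
    | "18 * int m + 4 \<le> x" "x < 30 * int m + 7"
    | "30 * int m + 7 \<le> x" "x < 42 * int m + 10"
    using x by fastforce
  then show "\<exists>d\<in>base_diagonals m. \<exists>i<12 * m + 3. \<bar>base_entry m d i\<bar> = x"
  proof cases
    case 1
    then obtain t e where "t < 4 * m + 1" "e \<in> {-4..1}" "x = offset m t + e"
      by (rule offset_cover)
    then show ?thesis using base_pair_cover[OF m] by blast
  next
    case 2
    then obtain i where i: "i < 12 * m + 3" "zigzag m i = x - (6 * int m + 1)"
      by (elim zigzag_surj[of "x - (6 * int m + 1)" m, rotated 2]) auto
    then have "\<bar>base_entry m 1 i\<bar> = x" using 2 unfolding base_entry_simps[OF m] by simp
    then show ?thesis using i(1) in_base by blast
  next
    case 3
    have "0 \<le> x - (18 * int m + 4)" "x - (18 * int m + 4) < 12 * int m + 3" using 3 by simp_all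
    then obtain i where i: "i < 12 * m + 3" "zigzag m i = x - (18 * int m + 4)"
      by (rule zigzag_surj)
    \<comment> \<open>Diagonal n - 1 carries the zigzag value of the preceding row.\<close>
    have "((i + 1) mod (12 * m + 3) + (12 * m + 2)) mod (12 * m + 3) = i"
      using i(1) by (simp add: mod_if)
    then have "\<bar>base_entry m (12 * m + 2) ((i + 1) mod (12 * m + 3))\<bar> = x"
      using 3 i(2) unfolding base_entry_simps[OF m] by simp
    moreover have "(i + 1) mod (12 * m + 3) < 12 * m + 3" by simp
    ultimately show ?thesis using in_base by blast
  next
    case 4
    have "0 \<le> x - (30 * int m + 7)" "x - (30 * int m + 7) < 12 * int m + 3" using 4 by simp_all
    \<comment> \<open>By the zigzag sums, the entry on diagonal 0 has absolute value 30m + 7 + (i -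
      R i - 1), with R the defect.\<close>
    then obtain i where i: "i < 12 * m + 3" "int i - defect m i - 1 = x - (30 * int m + 7)"
      by (rule defect_shift_surj)
    then have "\<bar>base_entry m 0 i\<bar> = x"
      using 4 unfolding base_entry_simps[OF m] zigzag_add_previous[OF i(1)] by simp
    then show ?thesis using i(1) in_base by blast
  qed
qed

section \<open>Filling up with free pairs\<close>

text \<open>New diagonals come in pairs 2t, 2t + 1, so halving records which pairs are already
  touched.\<close>

lemma base_diagonals_div_2: "(\<lambda>d. d div 2) ` base_diagonals m \<subseteq> {0, 2 * m, 4 * m + 1, 6 * m + 1}"
  by (auto simp: base_diagonals_def)

text \<open>The diagonals \<open>2 t\<close> and \<open>2 t + 1\<close> with \<open>t \<in> T\<close> are added to the base array.\<close>

lemma heffter_with_pairs: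
  assumes m: "1 \<le> m" and s: "2 * s \<le> 6 * m - 2"
  shows "\<exists>T F f. T \<subseteq> {1..6 * m} - {2 * m, 4 * m + 1} \<and> card T = 2 * s \<and>
    (\<lambda>d. d div 2) ` F \<subseteq> {0, 2 * m, 4 * m + 1, 6 * m + 1} \<union> T \<and> card F = 4 * s + 5 \<and>
    diagonal_heffter (12 * m + 3) F f"
  using s
proof (induction s)
  case 0
  show ?case
  proof (intro exI conjI)
    show "{} \<subseteq> {1..6 * m} - {2 * m, 4 * m + 1}" by (rule empty_subsetI)
    show "card {} = 2 * 0" by simp
    show "(\<lambda>d. d div 2) ` base_diagonals m \<subseteq> {0, 2 * m, 4 * m + 1, 6 * m + 1} \<union> {}"
      unfolding Un_empty_right by (rule base_diagonals_div_2)
    show "card (base_diagonals m) = 4 * 0 + 5" using card_base_diagonals[OF m] by simp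
    show "diagonal_heffter (12 * m + 3) (base_diagonals m) (base_entry m)" by (rule base_heffter[OF m])
  qed
next
  case (Suc s)
  let ?U = "{1..6 * m} - {2 * m, 4 * m + 1}" and ?E = "{0, 2 * m, 4 * m + 1, 6 * m + 1}"
  have "2 * s \<le> 6 * m - 2" using Suc.prems by simp
  then obtain T F f where T: "T \<subseteq> ?U" "card T = 2 * s"
    and F: "(\<lambda>d. d div 2) ` F \<subseteq> ?E \<union> T" "card F = 4 * s + 5"
    and f: "diagonal_heffter (12 * m + 3) F f"
    using Suc.IH by blast
  have fin: "finite T" using T(1) finite_subset by blast
  have "{2 * m, 4 * m + 1} \<subseteq> {1..6 * m}" "card {2 * m, 4 * m + 1} = 2" using m by auto
  \<comment> \<open>These are the pairs that the base array leaves free.\<close>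
  then have "card ?U = 6 * m - 2" by (simp add: card_Diff_subset)
  then have "2 \<le> card (?U - T)"
    using T Suc.prems by (simp add: card_Diff_subset[OF fin])
  then obtain S where "S \<subseteq> ?U - T" "card S = 2" by (meson obtain_subset_with_card_n)
  then obtain a b where ab: "a \<noteq> b" "a \<in> ?U - T" "b \<in> ?U - T"
    by (auto simp: card_2_iff)
  have free: "2 * c \<notin> F \<and> Suc (2 * c) \<notin> F \<and> Suc (2 * c) < 12 * m + 3" if "c \<in> ?U - T" for c
  proof -
    have "c \<notin> (\<lambda>d. d div 2) ` F" using that F(1) by auto
    moreover have "(2 * c) div 2 = c" "Suc (2 * c) div 2 = c" by simp_all
    ultimately have "2 * c \<notin> F" "Suc (2 * c) \<notin> F" by (metis image_eqI)+
    then show ?thesis using that by auto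
  qed
  let ?G = "F \<union> {2 * a, Suc (2 * a), 2 * b, Suc (2 * b)}"
  have ne: "2 * a \<noteq> 2 * b" "2 * a \<noteq> Suc (2 * b)" "2 * b \<noteq> Suc (2 * a)"
    using ab(1) by presburger+
  obtain g where "diagonal_heffter (12 * m + 3) ?G g"
    using diagonal_heffter_add_two_pairs[OF f] free[OF ab(2)] free[OF ab(3)] ne by blast
  moreover have "card ?G = 4 * Suc s + 5"
  proof -
    have "finite F" using F(2) card_ge_0_finite[of F] by simp
    then have "card ?G = card F + card {2 * a, Suc (2 * a), 2 * b, Suc (2 * b)}"
      using free[OF ab(2)] free[OF ab(3)] by (intro card_Un_disjoint) auto
    then show ?thesis using ne F(2) by simp
  qed
  moreover have "(\<lambda>d. d div 2) ` ?G \<subseteq> ?E \<union> insert a (insert b T)" using F(1) by auto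
  moreover have "card (insert a (insert b T)) = 2 * Suc s"
    using ab fin T(2) by simp
  moreover have "insert a (insert b T) \<subseteq> ?U" using ab T(1) by blast
  ultimately show ?case by blast
qed

theorem theorem4p16:
  fixes m k :: nat
  assumes "m \<ge> 1" and "k mod 4 = 1" and "5 \<le> k" and "k < 12 * m + 3"
  shows "\<exists>A. is_heffter_array (12 * m + 3) k A"
proof -
  define s where "s = (k - 5) div 4"
  have k: "k = 4 * s + 5" using assms(2,3) unfolding s_def by presburger
  \<comment> \<open>For the largest admissible k, namely 12m + 1, all 6m - 2 free pairs are used
    up.\<close>
  have "2 * s \<le> 6 * m - 2" using assms(4) k by simp
  then obtain F f where "card F = k" "diagonal_heffter (12 * m + 3) F f"
    using heffter_with_pairs[OF assms(1)] k by blast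
  then show ?thesis using diagonal_heffter_imp_heffter_array by blast
qed

end
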